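(* For every integer $r\geq 1$ there is a realizable oriented matroid $\mathcal{M}=(E,\mathcal{C})$ of rank $r$, an element $e\in E$, and $e$-embracing bases $B,B'$ of $\mathcal{M}$ such that $d_e(B,B')\geq \lfloor\frac{5}{4}r\rfloor$.
   Context: Oriented matroids have finite ground set $E$ and are given by their set $\mathcal{C}$ of signed circuits; $\underline{X}$ denotes the support of a signed set $X$. A circuit $X\in\mathcal{C}$ is positive if $X(f)\in\{0,+\}$ for all $f\in E$; $\mathcal{C}_e^+$ is the set of positive circuits $X$ with $X(e)=+$. For a basis $B$ (of the underlying matroid) with $e\notin B$, the fundamental circuit $C(B,e)$ is the unique $X\in\mathcal{C}$ with $\underline{X}\subseteq B\cup\{e\}$ and $X(e)=+$. The basis $B$ (with $e\notin B$) is $e$-embracing if $C(B,e)\in\mathcal{C}_e^+$. The $e$-embracing distance $d_e(B,B')$ of two $e$-embracing bases is the minimum $k$ such that there is a sequence $B=B_0,B_1,\ldots,B_k=B'$ of $e$-embracing bases with $|B_{i-1}\Delta B_i|=2$ for all $i\in\{1,\dots,k\}$ ($\infty$ if there is none). An oriented matroid is realizable if it is the oriented matroid of linear dependencies of a finite family of vectors in a real vector space. *)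

theory Defs
  imports Complex_Main "HOL-Library.Extended_Nat"
begin

text \<open>
  A signed subset of the ground set \<open>E\<close> is a function \<open>X :: 'a \<Rightarrow> int\<close> with values in \<open>{-1, 0, 1}\<close>
  that vanishes outside \<open>E\<close>; the values \<open>1\<close> and \<open>-1\<close> stand for the signs plus and minus.
\<close>

definition supp :: "('a \<Rightarrow> 'b::zero) \<Rightarrow> 'a set" where
  "supp X = {f. X f \<noteq> 0}"

definition signed_subset :: "'a set \<Rightarrow> ('a \<Rightarrow> int) \<Rightarrow> bool" where
  "signed_subset E X \<longleftrightarrow> range X \<subseteq> {-1, 0, 1} \<and> supp X \<subseteq> E"

text \<open>
  The signed circuit axioms: nonemptiness, symmetry, incomparability and weak elimination.
\<close>

definition oriented_matroid :: "'a set \<Rightarrow> ('a \<Rightarrow> int) set \<Rightarrow> bool" where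
  "oriented_matroid E C \<longleftrightarrow>
     finite E \<and>
     (\<forall>X\<in>C. signed_subset E X) \<and>
     (\<forall>X\<in>C. supp X \<noteq> {}) \<and>
     (\<forall>X\<in>C. (\<lambda>f. - X f) \<in> C) \<and>
     (\<forall>X\<in>C. \<forall>Y\<in>C. supp X \<subseteq> supp Y \<longrightarrow> X = Y \<or> X = (\<lambda>f. - Y f)) \<and>
     (\<forall>X\<in>C. \<forall>Y\<in>C. \<forall>g. X \<noteq> (\<lambda>f. - Y f) \<and> X g = 1 \<and> Y g = -1 \<longrightarrow>
        (\<exists>Z\<in>C. Z g = 0 \<and>
           (\<forall>f. Z f = 1 \<longrightarrow> X f = 1 \<or> Y f = 1) \<and>
           (\<forall>f. Z f = -1 \<longrightarrow> X f = -1 \<or> Y f = -1)))"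

definition indep_set :: "'a set \<Rightarrow> ('a \<Rightarrow> int) set \<Rightarrow> 'a set \<Rightarrow> bool" where
  "indep_set E C I \<longleftrightarrow> I \<subseteq> E \<and> \<not> (\<exists>X\<in>C. supp X \<subseteq> I)"

definition is_basis :: "'a set \<Rightarrow> ('a \<Rightarrow> int) set \<Rightarrow> 'a set \<Rightarrow> bool" where
  "is_basis E C B \<longleftrightarrow> indep_set E C B \<and> (\<forall>I. indep_set E C I \<and> B \<subseteq> I \<longrightarrow> I = B)"

definition om_rank :: "'a set \<Rightarrow> ('a \<Rightarrow> int) set \<Rightarrow> nat" where
  "om_rank E C = Max (card ` {I. indep_set E C I})"

text \<open>
  \<open>D\<close> is meant to be the space of linear dependencies of a finite family of vectors. Its signed
  circuits are the sign patterns of the nonzero dependencies of inclusion-minimal support.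
\<close>

definition sign_circuits :: "('a \<Rightarrow> real) set \<Rightarrow> ('a \<Rightarrow> int) set" where
  "sign_circuits D =
     {X. \<exists>l\<in>D. supp l \<noteq> {} \<and>
           (\<forall>m\<in>D. supp m \<noteq> {} \<and> supp m \<subseteq> supp l \<longrightarrow> supp m = supp l) \<and>
           (\<forall>f. real_of_int (X f) = sgn (l f))}"

text \<open>
  HOL cannot quantify existentially over the type of the ambient vector space. Since a finite
  family spans a finite-dimensional space, it is enough to consider families in \<open>\<real>\<^sup>d\<close> for arbitrary
  \<open>d\<close>; the vector \<open>v f\<close> has the coordinates \<open>v f i\<close> with \<open>i < d\<close>. Lemma
  \<open>realizable_real_vector\<close> below confirms that families in arbitrary real vector spaces are covered.
\<close>

definition realizable :: "'a set \<Rightarrow> ('a \<Rightarrow> int) set \<Rightarrow> bool" where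
  "realizable E C \<longleftrightarrow>
     finite E \<and>
     (\<exists>(d::nat) (v :: 'a \<Rightarrow> nat \<Rightarrow> real).
        C = sign_circuits {l. supp l \<subseteq> E \<and> (\<forall>i<d. (\<Sum>f\<in>E. l f * v f i) = 0)})"

lemma realizable_real_vector:
  fixes v :: "'a \<Rightarrow> 'v::real_vector"
  assumes E: "finite E"
  shows "realizable E (sign_circuits {l. supp l \<subseteq> E \<and> (\<Sum>f\<in>E. l f *\<^sub>R v f) = 0})"
proof -
  obtain B where B: "B \<subseteq> v ` E" "independent B" "v ` E \<subseteq> span B"
    using real_vector.maximal_independent_subset by blast
  have finB: "finite B"
    using B(1) E finite_surj by blast
  obtain h where h: "bij_betw h {0..<card B} B"
    using ex_bij_betw_nat_finite[OF finB] by blast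
  define w where "w f i = real_vector.representation B (v f) (h i)" for f i
  have eq: "(\<Sum>f\<in>E. l f *\<^sub>R v f) = 0 \<longleftrightarrow> (\<forall>i<card B. (\<Sum>f\<in>E. l f * w f i) = 0)" for l
  proof -
    let ?s = "\<Sum>f\<in>E. l f *\<^sub>R v f"
    have sp: "v f \<in> span B" if "f \<in> E" for f
      using B(3) that by blast
    have sps: "?s \<in> span B"
      by (intro real_vector.span_sum real_vector.span_scale sp)
    have rep: "real_vector.representation B ?s b =
        (\<Sum>f\<in>E. l f * real_vector.representation B (v f) b)" for b
      using B(2) sp
      by (simp add: real_vector.representation_sum real_vector.representation_scale
          real_vector.span_scale)
    have "?s = 0 \<longleftrightarrow> (\<forall>b\<in>B. real_vector.representation B ?s b = 0)"
    proof
      assume "?s = 0"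
      then show "\<forall>b\<in>B. real_vector.representation B ?s b = 0"
        by (simp add: real_vector.representation_zero)
    next
      assume *: "\<forall>b\<in>B. real_vector.representation B ?s b = 0"
      have "(\<Sum>b\<in>B. real_vector.representation B ?s b *\<^sub>R b) = ?s"
        using real_vector.sum_representation_eq[OF B(2) sps finB order_refl] .
      with * show "?s = 0"
        by simp
    qed
    also have "\<dots> \<longleftrightarrow> (\<forall>i<card B. real_vector.representation B ?s (h i) = 0)"
    proof -
      have "(\<forall>b\<in>B. P b) \<longleftrightarrow> (\<forall>i<card B. P (h i))" for P
        using bij_betw_ball[OF h, of P] by (simp add: Ball_def)
      then show ?thesis .
    qed
    finally show ?thesis
      unfolding rep w_def .
  qed
  show ?thesis
    unfolding realizable_def eq using E by blast
qed

definition positive :: "('a \<Rightarrow> int) \<Rightarrow> bool" where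
  "positive X \<longleftrightarrow> (\<forall>f. X f \<in> {0, 1})"

definition positive_circuits_at :: "('a \<Rightarrow> int) set \<Rightarrow> 'a \<Rightarrow> ('a \<Rightarrow> int) set" where
  "positive_circuits_at C e = {X \<in> C. positive X \<and> X e = 1}"

text \<open>Meaningful only if \<open>B\<close> is a basis and \<open>e \<in> E - B\<close>, when the circuit exists and is unique.\<close>

definition fundamental_circuit :: "('a \<Rightarrow> int) set \<Rightarrow> 'a set \<Rightarrow> 'a \<Rightarrow> ('a \<Rightarrow> int)" where
  "fundamental_circuit C B e = (THE X. X \<in> C \<and> supp X \<subseteq> B \<union> {e} \<and> X e = 1)"

definition embracing :: "'a set \<Rightarrow> ('a \<Rightarrow> int) set \<Rightarrow> 'a \<Rightarrow> 'a set \<Rightarrow> bool" where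
  "embracing E C e B \<longleftrightarrow>
     is_basis E C B \<and> e \<in> E - B \<and> fundamental_circuit C B e \<in> positive_circuits_at C e"

definition embracing_path ::
    "'a set \<Rightarrow> ('a \<Rightarrow> int) set \<Rightarrow> 'a \<Rightarrow> 'a set \<Rightarrow> 'a set \<Rightarrow> nat \<Rightarrow> bool" where
  "embracing_path E C e B B' k \<longleftrightarrow>
     (\<exists>Bs :: nat \<Rightarrow> 'a set. Bs 0 = B \<and> Bs k = B' \<and>
        (\<forall>i\<le>k. embracing E C e (Bs i)) \<and>
        (\<forall>i\<in>{1..k}. card ((Bs (i - 1) - Bs i) \<union> (Bs i - Bs (i - 1))) = 2))"

text \<open>The infimum of the empty set in \<open>enat\<close> is \<open>\<infinity>\<close>.\<close>

definition embracing_dist ::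
    "'a set \<Rightarrow> ('a \<Rightarrow> int) set \<Rightarrow> 'a \<Rightarrow> 'a set \<Rightarrow> 'a set \<Rightarrow> enat" where
  "embracing_dist E C e B B' = Inf {enat k |k. embracing_path E C e B B' k}"

end

theory Submission
  imports Defs
begin

text \<open>
  For a vector configuration, an \<open>e\<close>-embracing basis is a linear basis whose cone contains \<open>p = - v e\<close>
  (\<open>embracing_iff_cone_basis\<close>). In the nondegenerate case these bases are the supports of
  the vertices of the polyhedron of nonnegative solutions \<open>x\<close> of the system \<open>(\<Sum>f. x f * v f i) = p i\<close>, and
  exchanging one element is a pivot step of the simplex algorithm, which moves along an edge. With \<open>2 * r\<close>
  vectors in rank \<open>r\<close> the polyhedron has dimension \<open>r\<close> and at most \<open>2 * r\<close> facets, and the Hirsch bound for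
  the distance of two vertices is \<open>r\<close>. So a polyhedron that violates this bound is wanted.
  
  Klee and Walkup showed that for unbounded polyhedra this happens in dimension four with eight facets,
  where two vertices can be at distance five. The file fixes explicit vectors for such a polyhedron
  (\<open>kw_vector\<close>). Twenty separating hyperplanes leave only fifteen sets of four vectors as candidates for
  embracing bases, these fall into six layers, and no exchange skips a layer (\<open>far_cone_bases_4\<close>).
  
  In a direct sum of configurations, with the pair of the targets as target, a set is an embracing basis
  exactly if its two parts are, and an exchange affects one part only. So distances add up
  (\<open>far_cone_bases_add\<close>). Copies of the configuration of rank four, together with at most three copies of a
  configuration of rank one that has two embracing bases at distance one, give the bound for every
  rank.
  
  That the signed circuits of linear dependencies satisfy the circuit axioms rests on
  \<open>minimal_below_conformal\<close>: every dependency conforms in sign to some minimal dependency.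
\<close>

section \<open>Homogeneous linear systems\<close>

text \<open>
  Gaussian elimination, one equation at a time: if some coefficient of the new equation is nonzero,
  that equation determines one unknown from the others, and substituting it leaves a system with one
  unknown and one equation less. All dimension arguments below come from this statement.
\<close>

lemma homogeneous_system_solvable:
  fixes u :: "'a \<Rightarrow> 'b \<Rightarrow> real"
  assumes "finite I" "finite J" "card I < card J"
  shows "\<exists>l. (\<exists>f\<in>J. l f \<noteq> 0) \<and> (\<forall>i\<in>I. (\<Sum>f\<in>J. l f * u f i) = 0)"
  using assms
proof (induction I arbitrary: J u rule: finite_induct)
  case empty
  then have "J \<noteq> {}" by auto
  then show ?case by (intro exI[of _ "\<lambda>_. 1"]) auto
next
  case (insert i I)
  show ?case
  proof (cases "\<forall>f\<in>J. u f i = 0")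
    case True
    obtain l where l: "\<exists>f\<in>J. l f \<noteq> 0" "\<forall>k\<in>I. (\<Sum>f\<in>J. l f * u f k) = 0"
      using insert.IH[of J u] insert.prems insert.hyps by auto
    have "(\<Sum>f\<in>J. l f * u f i) = 0"
      using True by simp
    with l show ?thesis by auto
  next
    case False
    then obtain g where g: "g \<in> J" "u g i \<noteq> 0" by blast
    define u' where "u' f k = u f k - u f i / u g i * u g k" for f k
    have "card I < card (J - {g})"
      using insert g by simp
    then obtain l where l: "\<exists>f\<in>J-{g}. l f \<noteq> 0"
        "\<forall>k\<in>I. (\<Sum>f\<in>J-{g}. l f * u' f k) = 0"
      using insert.IH[of "J - {g}" u'] insert.prems by auto
    define c where "c = - (\<Sum>f\<in>J-{g}. l f * u f i) / u g i"
    define l' where "l' = l(g := c)"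
    have split: "(\<Sum>f\<in>J. l' f * u f k) = (\<Sum>f\<in>J-{g}. l f * u f k) + c * u g k" for k
    proof -
      have "(\<Sum>f\<in>J. l' f * u f k) = l' g * u g k + (\<Sum>f\<in>J-{g}. l' f * u f k)"
        using g insert.prems by (simp add: sum.remove)
      also have "(\<Sum>f\<in>J-{g}. l' f * u f k) = (\<Sum>f\<in>J-{g}. l f * u f k)"
        by (intro sum.cong) (auto simp: l'_def)
      finally show ?thesis by (simp add: l'_def)
    qed
    have red: "(\<Sum>f\<in>J-{g}. l f * u f k) + c * u g k = (\<Sum>f\<in>J-{g}. l f * u' f k)" for k
    proof -
      have "(\<Sum>f\<in>J-{g}. l f * u' f k)
          = (\<Sum>f\<in>J-{g}. l f * u f k) - (\<Sum>f\<in>J-{g}. l f * u f i * (u g k / u g i))"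
        unfolding sum_subtractf[symmetric] u'_def by (simp add: algebra_simps)
      also have "(\<Sum>f\<in>J-{g}. l f * u f i * (u g k / u g i)) = - c * u g k"
        unfolding c_def sum_distrib_right[symmetric] by simp
      finally show ?thesis by simp
    qed
    have "(\<Sum>f\<in>J. l' f * u f k) = 0" if "k \<in> insert i I" for k
    proof (cases "k = i")
      case True
      then show ?thesis using split[of i] g by (simp add: c_def)
    next
      case False
      then show ?thesis using split[of k] red[of k] l that by auto
    qed
    moreover have "\<exists>f\<in>J. l' f \<noteq> 0"
      using l(1) by (auto simp: l'_def)
    ultimately show ?thesis by blast
  qed
qed

section \<open>Signed circuits of a linear subspace\<close>

definition lin_subspace :: "('a \<Rightarrow> real) set \<Rightarrow> bool" where
  "lin_subspace D \<longleftrightarrow> (\<forall>l\<in>D. \<forall>m\<in>D. \<forall>c. (\<lambda>f. l f + c * m f) \<in> D)"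

lemma lin_subspaceD:
  assumes "lin_subspace D" "l \<in> D"
  shows "m \<in> D \<Longrightarrow> (\<lambda>f. l f + c * m f) \<in> D" "(\<lambda>f. c * l f) \<in> D"
proof -
  show add: "(\<lambda>f. l f + c * m f) \<in> D" if "m \<in> D" for m c
    using assms that unfolding lin_subspace_def by blast
  have "(\<lambda>f. l f + (c - 1) * l f) \<in> D"
    using add[OF assms(2)] .
  then show "(\<lambda>f. c * l f) \<in> D"
    by (simp add: algebra_simps)
qed

definition minimal_in :: "('a \<Rightarrow> real) set \<Rightarrow> ('a \<Rightarrow> real) \<Rightarrow> bool" where
  "minimal_in D l \<longleftrightarrow> l \<in> D \<and> supp l \<noteq> {} \<and>
     (\<forall>m\<in>D. supp m \<noteq> {} \<and> supp m \<subseteq> supp l \<longrightarrow> supp m = supp l)"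

definition sign_vector :: "('a \<Rightarrow> real) \<Rightarrow> 'a \<Rightarrow> int" where
  "sign_vector l f = (if l f > 0 then 1 else if l f < 0 then -1 else 0)"

lemma sign_vector_iff: "(\<forall>f. real_of_int (X f) = sgn (l f)) \<longleftrightarrow> X = sign_vector l"
proof
  assume *: "\<forall>f. real_of_int (X f) = sgn (l f)"
  show "X = sign_vector l"
  proof
    fix f
    have "real_of_int (X f) = real_of_int (sign_vector l f)"
      using * by (auto simp: sign_vector_def sgn_if)
    then show "X f = sign_vector l f" by simp
  qed
qed (auto simp: sign_vector_def sgn_if)

lemma supp_sign_vector [simp]: "supp (sign_vector l) = supp l"
  by (auto simp: supp_def sign_vector_def)

lemma sign_circuits_eq: "sign_circuits D = sign_vector ` {l. minimal_in D l}"
  unfolding sign_circuits_def sign_vector_iff minimal_in_def by auto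

text \<open>
  Subtracting the multiple of \<open>l\<close> that cancels the entry at \<open>g\<close> leaves a vector whose support is
  properly contained in that of \<open>l\<close>, so it vanishes by minimality.
\<close>

lemma minimal_dependencies_proportional:
  assumes D: "lin_subspace D" and l: "minimal_in D l" and m: "m \<in> D"
    and sub: "supp m \<subseteq> supp l" and g: "l g \<noteq> 0"
  shows "m = (\<lambda>f. (m g / l g) * l f)"
proof -
  define z where "z f = m f + (- (m g / l g)) * l f" for f
  have zD: "z \<in> D"
    using lin_subspaceD(1)[OF D m] l unfolding z_def minimal_in_def by blast
  have "supp z \<subseteq> supp l" "g \<in> supp l" "g \<notin> supp z"
    using sub g by (auto simp: supp_def z_def)
  moreover have "supp z = {} \<or> \<not> supp z \<subseteq> supp l \<or> supp z = supp l"
    using l zD unfolding minimal_in_def by blast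
  ultimately have "supp z = {}"
    by blast
  then have z0: "z f = 0" for f
    by (simp add: supp_def)
  have "m f = (m g / l g) * l f" for f
    using z0[of f] unfolding z_def by linarith
  then show ?thesis by (rule ext)
qed

text \<open>
  This is the reason why signed circuits can be eliminated. If \<open>l\<close> is not itself minimal, take \<open>m\<close> of
  smaller support that agrees in sign with \<open>l\<close> somewhere, and move from \<open>l\<close> in the direction \<open>-m\<close>
  until the first coordinate vanishes. No sign has been flipped on the way, the support has
  shrunk, and the result is nonzero because \<open>l\<close> and \<open>m\<close> have different supports.
\<close>

lemma minimal_below_conformal:
  assumes D: "lin_subspace D" and l: "l \<in> D" "supp l \<noteq> {}" and fin: "finite (supp l)"
  shows "\<exists>m. minimal_in D m \<and> (\<forall>f. m f \<noteq> 0 \<longrightarrow> sgn (m f) = sgn (l f))"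
  using l fin
proof (induction "card (supp l)" arbitrary: l rule: less_induct)
  case less
  show ?case
  proof (cases "minimal_in D l")
    case True
    then show ?thesis by blast
  next
    case False
    then obtain m0 where m0: "m0 \<in> D" "supp m0 \<noteq> {}" "supp m0 \<subset> supp l"
      using less.prems unfolding minimal_in_def by blast
    have "\<exists>m\<in>D. supp m \<subset> supp l \<and> (\<exists>f. m f * l f > 0)"
    proof -
      obtain g where g: "m0 g \<noteq> 0" using m0 by (auto simp: supp_def)
      then have lg: "l g \<noteq> 0" using m0 by (auto simp: supp_def)
      \<comment> \<open>The factor makes the entry at \<open>g\<close> agree in sign with \<open>l g\<close>.\<close>
      define m where "m f = (m0 g * l g) * m0 f" for f
      have "m \<in> D" using lin_subspaceD(2)[OF D m0(1)] unfolding m_def by blast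
      moreover have "supp m = supp m0" using g lg by (auto simp: supp_def m_def)
      moreover have "m g * l g > 0"
      proof -
        have "m g * l g = (m0 g * l g)\<^sup>2" by (simp add: m_def power2_eq_square)
        then show ?thesis using g lg by simp
      qed
      ultimately show ?thesis using m0 by metis
    qed
    then obtain m where m: "m \<in> D" "supp m \<subset> supp l" "\<exists>f. m f * l f > 0" by blast
    define P where "P = {f. m f * l f > 0}"
    have P: "P \<noteq> {}" "finite P"
      using m less.prems(3) by (auto simp: P_def supp_def elim!: rev_finite_subset)
    \<comment> \<open>Only coordinates in \<open>P\<close> shrink in absolute value; the first of them vanishes at step length \<open>t\<close>.\<close>
    define t where "t = Min ((\<lambda>f. l f / m f) ` P)"
    have "t \<in> (\<lambda>f. l f / m f) ` P"
      unfolding t_def using P by (intro Min_in) auto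
    then obtain g where g: "g \<in> P" "t = l g / m g" by blast
    have t: "t \<le> l f / m f" if "f \<in> P" for f
      unfolding t_def using P that by (intro Min_le) auto
    have tpos: "t > 0" using g by (auto simp: P_def zero_less_divide_iff zero_less_mult_iff)
    define z where "z f = l f + (- t) * m f" for f
    have zD: "z \<in> D"
      using lin_subspaceD(1)[OF D less.prems(1) m(1)] unfolding z_def by blast
    have conf: "sgn (z f) = sgn (l f)" if "z f \<noteq> 0" for f
    proof (cases "f \<in> P")
      case True
      then have "t \<le> l f / m f" by (rule t)
      with True that show ?thesis
        by (auto simp: P_def z_def sgn_if zero_less_mult_iff field_simps)
    next
      case False
      then have nle: "m f * l f \<le> 0" by (simp add: P_def)
      have ms: "l f = 0 \<Longrightarrow> m f = 0" using m(2) by (auto simp: supp_def)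
      consider "l f > 0" "m f \<le> 0" | "l f < 0" "m f \<ge> 0" | "l f = 0" "m f = 0"
        using nle ms by (cases "l f" "0 :: real" rule: linorder_cases) (auto simp: mult_le_0_iff)
      then show ?thesis
      proof cases
        case 1
        then have "t * m f \<le> 0" using tpos by (simp add: mult_le_0_iff)
        with 1 show ?thesis by (simp add: z_def)
      next
        case 2
        then have "t * m f \<ge> 0" using tpos by simp
        with 2 show ?thesis by (simp add: z_def)
      qed (simp add: z_def)
    qed
    have sub: "supp z \<subseteq> supp l"
      using conf unfolding supp_def by (metis (mono_tags, lifting) mem_Collect_eq sgn_zero_iff subsetI)
    have "g \<in> supp l" "g \<notin> supp z" using g by (auto simp: P_def supp_def z_def)
    then have card: "card (supp z) < card (supp l)"
      using sub less.prems(3) by (intro psubset_card_mono) auto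
    obtain h where h: "h \<in> supp l" "h \<notin> supp m" using m(2) by blast
    then have "h \<in> supp z" by (auto simp: supp_def z_def)
    then have "supp z \<noteq> {}" by blast
    then obtain w where w: "minimal_in D w" "\<forall>f. w f \<noteq> 0 \<longrightarrow> sgn (w f) = sgn (z f)"
      using less.hyps[OF card zD] sub less.prems(3) finite_subset by blast
    then have "\<forall>f. w f \<noteq> 0 \<longrightarrow> sgn (w f) = sgn (l f)"
      using conf by (metis sgn_zero_iff)
    with w show ?thesis by blast
  qed
qed

lemma nested_circuits_opposite_or_equal:
  assumes D: "lin_subspace D" and l: "minimal_in D l" and m: "minimal_in D m"
    and sub: "supp l \<subseteq> supp m"
  shows "sign_vector l = sign_vector m \<or> sign_vector l = (\<lambda>f. - sign_vector m f)"
proof -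
  obtain g where g: "l g \<noteq> 0" "m g \<noteq> 0"
    using l sub unfolding minimal_in_def supp_def by blast
  have lD: "l \<in> D" using l by (simp add: minimal_in_def)
  have lm: "l = (\<lambda>f. (l g / m g) * m f)"
    by (rule minimal_dependencies_proportional[OF D m lD sub g(2)])
  define c where "c = l g / m g"
  have lf: "l f = c * m f" for f unfolding c_def using fun_cong[OF lm] .
  have "c \<noteq> 0" using g by (simp add: c_def)
  then consider "c > 0" | "c < 0" by linarith
  then show ?thesis
  proof cases
    case 1
    then have "sign_vector l = sign_vector m"
      by (simp add: fun_eq_iff sign_vector_def lf zero_less_mult_iff mult_less_0_iff)
    then show ?thesis ..
  next
    case 2
    then have "sign_vector l = (\<lambda>f. - sign_vector m f)"
      by (simp add: fun_eq_iff sign_vector_def lf zero_less_mult_iff mult_less_0_iff)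
    then show ?thesis ..
  qed
qed

text \<open>
  The combination of \<open>l\<close> and \<open>m\<close> with positive coefficients that cancels \<open>g\<close> has no sign that does
  not occur in \<open>l\<close> or \<open>m\<close>. It need not be a circuit, but some circuit conforms to it.
\<close>

lemma sign_circuits_eliminate:
  assumes D: "lin_subspace D" and fin: "\<And>l. l \<in> D \<Longrightarrow> finite (supp l)"
    and l: "minimal_in D l" and m: "minimal_in D m"
    and ne: "sign_vector l \<noteq> (\<lambda>f. - sign_vector m f)"
    and lg: "sign_vector l g = 1" and mg: "sign_vector m g = -1"
  shows "\<exists>Z\<in>sign_circuits D. Z g = 0 \<and>
        (\<forall>f. Z f = 1 \<longrightarrow> sign_vector l f = 1 \<or> sign_vector m f = 1) \<and>
        (\<forall>f. Z f = -1 \<longrightarrow> sign_vector l f = -1 \<or> sign_vector m f = -1)"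
proof -
  have s: "l g > 0" "m g < 0"
    using lg mg by (auto simp: sign_vector_def split: if_splits)
  define c where "c = l g / (- m g)"
  have c: "c > 0" unfolding c_def using s by (intro divide_pos_pos) auto
  define z where "z f = l f + c * m f" for f
  have "l \<in> D" "m \<in> D" using l m by (simp_all add: minimal_in_def)
  then have zD: "z \<in> D"
    using lin_subspaceD(1)[OF D, of l m c] by (simp add: z_def[abs_def])
  have zg: "z g = 0" using s by (simp add: z_def c_def)
  have "supp z \<noteq> {}"
  proof
    assume "supp z = {}"
    then have "z f = 0" for f by (simp add: supp_def)
    then have lf: "l f = - (c * m f)" for f
      using z_def[of f] by simp
    have "sign_vector l = (\<lambda>f. - sign_vector m f)"
      using c by (simp add: fun_eq_iff sign_vector_def lf zero_less_mult_iff mult_less_0_iff)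
    with ne show False by blast
  qed
  moreover have "finite (supp z)" using fin zD by blast
  ultimately obtain w where w: "minimal_in D w"
    "\<forall>f. w f \<noteq> 0 \<longrightarrow> sgn (w f) = sgn (z f)"
    using minimal_below_conformal[OF D zD] by blast
  have pos: "l f > 0 \<or> m f > 0" if "z f > 0" for f
  proof (rule ccontr)
    assume "\<not> ?thesis"
    then have "l f \<le> 0" "c * m f \<le> 0" using c by (auto simp: mult_le_0_iff)
    with that show False by (simp add: z_def)
  qed
  have ngt: "l f < 0 \<or> m f < 0" if "z f < 0" for f
  proof (rule ccontr)
    assume "\<not> ?thesis"
    then have "l f \<ge> 0" "c * m f \<ge> 0" using c by auto
    with that show False by (simp add: z_def)
  qed
  have wz: "w f > 0 \<Longrightarrow> z f > 0" "w f < 0 \<Longrightarrow> z f < 0" for f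
  proof -
    assume "w f > 0"
    then have "sgn (z f) > 0" using w(2) by (metis less_irrefl sgn_greater)
    then show "z f > 0" by simp
  next
    assume "w f < 0"
    then have "sgn (z f) < 0" using w(2) by (metis less_irrefl sgn_less)
    then show "z f < 0" by simp
  qed
  have wg: "w g = 0" using w(2) zg by (metis sgn_zero_iff)
  show ?thesis
  proof (intro bexI[of _ "sign_vector w"] conjI allI impI)
    show "sign_vector w g = 0"
      using wg by (simp add: sign_vector_def)
    show "sign_vector w \<in> sign_circuits D" using w by (auto simp: sign_circuits_eq)
  next
    fix f assume "sign_vector w f = 1"
    then have "w f > 0" by (auto simp: sign_vector_def split: if_splits)
    then have "l f > 0 \<or> m f > 0" using pos wz by blast
    then show "sign_vector l f = 1 \<or> sign_vector m f = 1"
      by (auto simp: sign_vector_def)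
  next
    fix f assume "sign_vector w f = - 1"
    then have "w f < 0" by (auto simp: sign_vector_def split: if_splits)
    then have "l f < 0 \<or> m f < 0" using ngt wz by blast
    then show "sign_vector l f = -1 \<or> sign_vector m f = -1"
      by (auto simp: sign_vector_def)
  qed
qed

lemma sign_circuits_oriented_matroid:
  assumes E: "finite E" and D: "lin_subspace D" and sup: "\<forall>l\<in>D. supp l \<subseteq> E"
  shows "oriented_matroid E (sign_circuits D)"
proof -
  let ?C = "sign_circuits D"
  have fin: "finite (supp l)" if "l \<in> D" for l
    using sup that E finite_subset by blast
  have circuitE: "\<exists>l. minimal_in D l \<and> X = sign_vector l" if "X \<in> ?C" for X
    using that by (auto simp: sign_circuits_eq)
  have c1: "signed_subset E X" if X: "X \<in> ?C" for X
  proof -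
    obtain l where l: "minimal_in D l" "X = sign_vector l" using circuitE[OF X] by blast
    then have "supp l \<subseteq> E" using sup by (simp add: minimal_in_def)
    then show ?thesis
      unfolding signed_subset_def l supp_sign_vector by (auto simp: sign_vector_def)
  qed
  have c2: "supp X \<noteq> {}" if "X \<in> ?C" for X
    using circuitE[OF that] by (auto simp: minimal_in_def)
  have c3: "(\<lambda>f. - X f) \<in> ?C" if X: "X \<in> ?C" for X
  proof -
    obtain l where l: "minimal_in D l" "X = sign_vector l" using circuitE[OF X] by blast
    have "supp (\<lambda>f. - 1 * l f) = supp l" by (simp add: supp_def)
    then have "minimal_in D (\<lambda>f. - 1 * l f)"
      using l(1) lin_subspaceD(2)[OF D, of l "-1"] unfolding minimal_in_def by metis
    moreover have "(\<lambda>f. - X f) = sign_vector (\<lambda>f. - 1 * l f)"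
      by (auto simp: sign_vector_def l)
    ultimately show ?thesis by (auto simp: sign_circuits_eq)
  qed
  have c4: "X = Y \<or> X = (\<lambda>f. - Y f)"
    if X: "X \<in> ?C" and Y: "Y \<in> ?C" and sub: "supp X \<subseteq> supp Y" for X Y
  proof -
    obtain l where l: "minimal_in D l" "X = sign_vector l" using circuitE[OF X] by blast
    obtain m where m: "minimal_in D m" "Y = sign_vector m" using circuitE[OF Y] by blast
    show ?thesis
      using nested_circuits_opposite_or_equal[OF D l(1) m(1)] sub unfolding l m by simp
  qed
  have c5: "\<exists>Z\<in>?C. Z g = 0 \<and>
        (\<forall>f. Z f = 1 \<longrightarrow> X f = 1 \<or> Y f = 1) \<and>
        (\<forall>f. Z f = -1 \<longrightarrow> X f = -1 \<or> Y f = -1)"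
    if X: "X \<in> ?C" and Y: "Y \<in> ?C" and XY: "X \<noteq> (\<lambda>f. - Y f) \<and> X g = 1 \<and> Y g = -1" for X Y g
  proof -
    obtain l where l: "minimal_in D l" "X = sign_vector l" using circuitE[OF X] by blast
    obtain m where m: "minimal_in D m" "Y = sign_vector m" using circuitE[OF Y] by blast
    show ?thesis
      using sign_circuits_eliminate[OF D fin l(1) m(1), of g] XY unfolding l m by blast
  qed
  show ?thesis
    unfolding oriented_matroid_def
    by (intro conjI ballI allI impI) (rule E c1 c2 c3 c4 c5; assumption)+
qed

section \<open>Vector configurations and their oriented matroids\<close>

definition lin_indep :: "nat \<Rightarrow> ('a \<Rightarrow> nat \<Rightarrow> real) \<Rightarrow> 'a set \<Rightarrow> bool" where
  "lin_indep d v A \<longleftrightarrow>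
     (\<forall>l. (\<forall>i<d. (\<Sum>f\<in>A. l f * v f i) = 0) \<longrightarrow> (\<forall>f\<in>A. l f = 0))"

definition dependencies :: "'a set \<Rightarrow> nat \<Rightarrow> ('a \<Rightarrow> nat \<Rightarrow> real) \<Rightarrow> ('a \<Rightarrow> real) set" where
  "dependencies E d v = {l. supp l \<subseteq> E \<and> (\<forall>i<d. (\<Sum>f\<in>E. l f * v f i) = 0)}"

lemma lin_subspace_dependencies: "lin_subspace (dependencies E d v)"
  unfolding lin_subspace_def
proof (intro ballI allI)
  fix l m and c :: real
  assume l: "l \<in> dependencies E d v" and m: "m \<in> dependencies E d v"
  have "(\<Sum>f\<in>E. (l f + c * m f) * v f i)
      = (\<Sum>f\<in>E. l f * v f i) + c * (\<Sum>f\<in>E. m f * v f i)" for i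
    by (simp add: sum_distrib_left sum.distrib[symmetric] algebra_simps)
  moreover have "supp (\<lambda>f. l f + c * m f) \<subseteq> supp l \<union> supp m"
    by (auto simp: supp_def)
  ultimately show "(\<lambda>f. l f + c * m f) \<in> dependencies E d v"
    using l m unfolding dependencies_def by auto
qed

lemma dependencies_iff_supported:
  assumes E: "finite E" and A: "A \<subseteq> E" and l: "supp l \<subseteq> A"
  shows "l \<in> dependencies E d v \<longleftrightarrow> (\<forall>i<d. (\<Sum>f\<in>A. l f * v f i) = 0)"
proof -
  have "(\<Sum>f\<in>E. l f * v f i) = (\<Sum>f\<in>A. l f * v f i)" for i
    using l by (intro sum.mono_neutral_right[OF E A]) (auto simp: supp_def)
  then show ?thesis
    using A l by (auto simp: dependencies_def)
qed

lemma lin_indep_supported_zero: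
  assumes "finite E" "A \<subseteq> E" "lin_indep d v A" "l \<in> dependencies E d v" "supp l \<subseteq> A"
  shows "l f = 0"
proof (cases "f \<in> A")
  case True
  then show ?thesis
    using assms dependencies_iff_supported[OF assms(1,2,5)] unfolding lin_indep_def by blast
qed (use assms(5) in \<open>auto simp: supp_def\<close>)

lemma not_lin_indepE:
  assumes E: "finite E" and A: "A \<subseteq> E" and "\<not> lin_indep d v A"
  obtains l where "l \<in> dependencies E d v" "supp l \<subseteq> A" "supp l \<noteq> {}"
proof -
  obtain l f where l: "\<forall>i<d. (\<Sum>f\<in>A. l f * v f i) = 0" and f: "f \<in> A" "l f \<noteq> 0"
    using assms(3) unfolding lin_indep_def by blast
  define m where "m g = (if g \<in> A then l g else 0)" for g
  have sub: "supp m \<subseteq> A"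
    by (auto simp: supp_def m_def)
  have "(\<Sum>f\<in>A. m f * v f i) = (\<Sum>f\<in>A. l f * v f i)" for i
    by (intro sum.cong) (auto simp: m_def)
  then have "m \<in> dependencies E d v"
    using l dependencies_iff_supported[OF E A sub] by auto
  moreover have "f \<in> supp m"
    using f by (simp add: supp_def m_def)
  ultimately show ?thesis
    using that[OF _ sub] by blast
qed

lemma indep_set_iff_lin_indep:
  assumes E: "finite E"
  shows "indep_set E (sign_circuits (dependencies E d v)) I \<longleftrightarrow> I \<subseteq> E \<and> lin_indep d v I"
proof -
  have "(\<exists>X\<in>sign_circuits (dependencies E d v). supp X \<subseteq> I) \<longleftrightarrow> \<not> lin_indep d v I"
    if I: "I \<subseteq> E"
  proof
    assume "\<exists>X\<in>sign_circuits (dependencies E d v). supp X \<subseteq> I"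
    then obtain l where l: "l \<in> dependencies E d v" "supp l \<noteq> {}" "supp l \<subseteq> I"
      by (auto simp: sign_circuits_eq minimal_in_def)
    show "\<not> lin_indep d v I"
      using lin_indep_supported_zero[OF E I _ l(1,3)] l(2) by (auto simp: supp_def)
  next
    assume "\<not> lin_indep d v I"
    then obtain l where l: "l \<in> dependencies E d v" "supp l \<subseteq> I" "supp l \<noteq> {}"
      by (rule not_lin_indepE[OF E I])
    have "finite (supp l)"
      using l(2) I E by (meson finite_subset)
    then obtain m where m: "minimal_in (dependencies E d v) m"
        "\<forall>f. m f \<noteq> 0 \<longrightarrow> sgn (m f) = sgn (l f)"
      using minimal_below_conformal[OF lin_subspace_dependencies l(1,3)] by blast
    have "supp m \<subseteq> supp l"
      using m(2) unfolding supp_def by (metis (mono_tags, lifting) mem_Collect_eq sgn_zero_iff subsetI)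
    then show "\<exists>X\<in>sign_circuits (dependencies E d v). supp X \<subseteq> I"
      using m(1) l(2) by (auto simp: sign_circuits_eq)
  qed
  then show ?thesis
    unfolding indep_set_def by blast
qed

lemma lin_indep_card_le:
  assumes "finite A" "lin_indep d v A"
  shows "card A \<le> d"
proof (rule ccontr)
  assume "\<not> card A \<le> d"
  then obtain l where "\<exists>f\<in>A. l f \<noteq> 0" "\<forall>i\<in>{..<d}. (\<Sum>f\<in>A. l f * v f i) = 0"
    using homogeneous_system_solvable[of "{..<d}" A v] assms(1) by auto
  then show False
    using assms(2) unfolding lin_indep_def by auto
qed

text \<open>
  All vectors are combinations of those in a maximal independent set \<open>B\<close>. If \<open>J\<close> were larger than
  \<open>B\<close>, the vanishing of the \<open>card B\<close> coefficients would be a system with more unknowns than equations,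
  whose solution is a dependency on \<open>J\<close>.
\<close>

lemma maximal_lin_indep_card_ge:
  assumes E: "finite E" and B: "B \<subseteq> E" "lin_indep d v B"
    and max: "\<And>f. f \<in> E - B \<Longrightarrow> \<not> lin_indep d v (insert f B)"
    and J: "J \<subseteq> E" "lin_indep d v J"
  shows "card J \<le> card B"
proof (rule ccontr)
  assume less: "\<not> card J \<le> card B"
  have fin: "finite B" "finite J"
    using B J E finite_subset by auto
  have "\<exists>c. \<forall>i<d. v f i = (\<Sum>b\<in>B. c b * v b i)" if f: "f \<in> E" for f
  proof (cases "f \<in> B")
    case True
    have "v f i = (\<Sum>b\<in>B. (if b = f then 1 else 0) * v b i)" for i
      using True fin by (simp add: if_distrib[of "\<lambda>x. x * _"] cong: if_cong)
    then show ?thesis by (intro exI[of _ "\<lambda>b. if b = f then 1 else 0"]) blast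
  next
    case False
    then have "\<not> lin_indep d v (insert f B)" using max f by blast
    then obtain l g where l: "\<forall>i<d. (\<Sum>b\<in>insert f B. l b * v b i) = 0"
        and g: "g \<in> insert f B" "l g \<noteq> 0"
      unfolding lin_indep_def by blast
    have split: "l f * v f i + (\<Sum>b\<in>B. l b * v b i) = 0" if "i < d" for i
      using l False fin that by auto
    have lf: "l f \<noteq> 0"
    proof
      assume "l f = 0"
      then have "\<forall>b\<in>B. l b = 0"
        using split B(2) unfolding lin_indep_def by simp
      with g \<open>l f = 0\<close> show False by auto
    qed
    have "v f i = (\<Sum>b\<in>B. (- l b / l f) * v b i)" if "i < d" for i
    proof -
      have "(\<Sum>b\<in>B. (- l b / l f) * v b i) = - (\<Sum>b\<in>B. l b * v b i) / l f"
        by (simp add: sum_divide_distrib sum_negf)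
      also have "\<dots> = v f i"
        using split[OF that] lf by (simp add: field_simps)
      finally show ?thesis by simp
    qed
    then show ?thesis by (intro exI[of _ "\<lambda>b. - l b / l f"]) simp
  qed
  then obtain c where c: "\<And>f i. f \<in> E \<Longrightarrow> i < d \<Longrightarrow> v f i = (\<Sum>b\<in>B. c f b * v b i)"
    by metis
  obtain l where l: "\<exists>f\<in>J. l f \<noteq> 0" "\<forall>b\<in>B. (\<Sum>f\<in>J. l f * c f b) = 0"
    using homogeneous_system_solvable[of B J c] fin less by auto
  have "(\<Sum>f\<in>J. l f * v f i) = 0" if i: "i < d" for i
  proof -
    have "(\<Sum>f\<in>J. l f * v f i) = (\<Sum>f\<in>J. \<Sum>b\<in>B. l f * c f b * v b i)"
      using c[OF _ i] J(1) by (intro sum.cong refl) (auto simp: sum_distrib_left mult.assoc)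
    also have "\<dots> = (\<Sum>b\<in>B. (\<Sum>f\<in>J. l f * c f b) * v b i)"
      by (subst sum.swap) (simp add: sum_distrib_right)
    also have "\<dots> = 0" using l(2) by simp
    finally show ?thesis .
  qed
  then show False
    using l(1) J(2) unfolding lin_indep_def by blast
qed

text \<open>
  On \<open>insert e B\<close> with \<open>B\<close> independent, a dependency is determined by its value at \<open>e\<close>. Hence all
  dependencies there are multiples of \<open>l\<close>, which makes \<open>l\<close> minimal and its sign vector the only
  candidate for the fundamental circuit.
\<close>

lemma fundamental_circuit_of_dependency:
  assumes E: "finite E" and B: "B \<subseteq> E" "lin_indep d v B" and e: "e \<in> E - B"
    and l: "l \<in> dependencies E d v" "supp l \<subseteq> insert e B" "l e > 0"
  shows "sign_vector l \<in> sign_circuits (dependencies E d v)"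
    and "fundamental_circuit (sign_circuits (dependencies E d v)) B e = sign_vector l"
proof -
  let ?D = "dependencies E d v"
  have proportional: "m f = (m e / l e) * l f" if m: "m \<in> ?D" "supp m \<subseteq> insert e B" for m f
  proof -
    define z where "z f = m f + (- (m e / l e)) * l f" for f
    have z: "z \<in> ?D"
      using lin_subspaceD(1)[OF lin_subspace_dependencies m(1) l(1), of "- (m e / l e)"]
      by (simp add: z_def[abs_def])
    have "supp z \<subseteq> supp m \<union> supp l" "e \<notin> supp z"
      using l(3) by (auto simp: supp_def z_def)
    then have "supp z \<subseteq> B"
      using m(2) l(2) by blast
    then have "z f = 0"
      by (rule lin_indep_supported_zero[OF E B z])
    then show ?thesis unfolding z_def by linarith
  qed
  have min: "minimal_in ?D l"
    unfolding minimal_in_def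
  proof (intro conjI ballI impI)
    have "e \<in> supp l" using l(3) by (simp add: supp_def)
    then show "supp l \<noteq> {}" by blast
    fix m assume m: "m \<in> ?D" "supp m \<noteq> {} \<and> supp m \<subseteq> supp l"
    have eq: "m f = (m e / l e) * l f" for f
      using proportional[OF m(1)] m(2) l(2) by blast
    have "m e \<noteq> 0"
    proof
      assume "m e = 0"
      then have "m f = 0" for f using eq[of f] by simp
      with m(2) show False by (simp add: supp_def)
    qed
    then have "m f \<noteq> 0 \<longleftrightarrow> l f \<noteq> 0" for f
      using eq[of f] l(3) by (metis divide_eq_0_iff less_irrefl mult_eq_0_iff)
    then show "supp m = supp l" by (simp add: supp_def)
  qed (rule l)
  then show circ: "sign_vector l \<in> sign_circuits ?D"
    by (auto simp: sign_circuits_eq)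
  show "fundamental_circuit (sign_circuits ?D) B e = sign_vector l"
    unfolding fundamental_circuit_def
  proof (rule the_equality)
    show "sign_vector l \<in> sign_circuits ?D \<and> supp (sign_vector l) \<subseteq> B \<union> {e} \<and> sign_vector l e = 1"
      unfolding supp_sign_vector using circ l by (auto simp: sign_vector_def)
    fix X assume X: "X \<in> sign_circuits ?D \<and> supp X \<subseteq> B \<union> {e} \<and> X e = 1"
    then obtain m where m: "m \<in> ?D" "X = sign_vector m"
      by (auto simp: sign_circuits_eq minimal_in_def)
    then have sub: "supp m \<subseteq> insert e B" and "m e > 0"
      using X by (auto simp: sign_vector_def split: if_splits)
    then have c: "m e / l e > 0" using l(3) by simp
    have "sign_vector m f = sign_vector l f" for f
      unfolding sign_vector_def proportional[OF m(1) sub, of f]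
      using c by (simp only: zero_less_mult_iff mult_less_0_iff) auto
    then show "X = sign_vector l" using m(2) by blast
  qed
qed

text \<open>
  This translates the combinatorial notion into geometry: \<open>B\<close> embraces \<open>e\<close> exactly if it is a
  linear basis whose closed convex cone contains the vector opposite to \<open>v e\<close>. The signs of the coordinates of
  that vector are the entries of the fundamental circuit outside \<open>e\<close>. The set \<open>S\<close>
  witnesses that the configuration has full rank \<open>d\<close>.
\<close>

lemma embracing_iff_cone_basis:
  fixes v :: "'a \<Rightarrow> nat \<Rightarrow> real"
  assumes E: "finite E" and e: "e \<in> E"
    and full: "S \<subseteq> E" "lin_indep d v S" "card S = d"
  shows "embracing E (sign_circuits (dependencies E d v)) e B \<longleftrightarrow>
    B \<subseteq> E - {e} \<and> card B = d \<and> lin_indep d v B \<and>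
    (\<exists>x. (\<forall>f\<in>B. 0 \<le> x f) \<and> (\<forall>i<d. (\<Sum>f\<in>B. x f * v f i) = - v e i))"
    (is "?emb \<longleftrightarrow> ?cone")
proof
  let ?D = "dependencies E d v"
  assume ?emb
  then have basis: "is_basis E (sign_circuits ?D) B" and eB: "e \<in> E - B"
    and circ: "fundamental_circuit (sign_circuits ?D) B e \<in> positive_circuits_at (sign_circuits ?D) e"
    unfolding embracing_def by auto
  have B: "B \<subseteq> E" "lin_indep d v B"
    and max: "\<And>I. I \<subseteq> E \<Longrightarrow> lin_indep d v I \<Longrightarrow> B \<subseteq> I \<Longrightarrow> I = B"
    using basis unfolding is_basis_def indep_set_iff_lin_indep[OF E] by auto
  have finB: "finite B" using B(1) E finite_subset by blast
  have dep: "\<not> lin_indep d v (insert f B)" if "f \<in> E - B" for f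
    using max[of "insert f B"] B(1) that by blast
  have "card S \<le> card B"
    by (rule maximal_lin_indep_card_ge[OF E B dep full(1,2)])
  moreover have "card B \<le> d"
    by (rule lin_indep_card_le[OF finB B(2)])
  ultimately have card: "card B = d" using full(3) by simp
  obtain l0 where l0: "l0 \<in> ?D" "supp l0 \<subseteq> insert e B" "supp l0 \<noteq> {}"
    using not_lin_indepE[OF E _ dep[OF eB]] B(1) e by blast
  have "l0 e \<noteq> 0"
  proof
    assume "l0 e = 0"
    then have "supp l0 \<subseteq> B" using l0(2) by (auto simp: supp_def)
    then have "l0 f = 0" for f by (rule lin_indep_supported_zero[OF E B l0(1)])
    then show False using l0(3) by (simp add: supp_def)
  qed
  define l where "l f = (1 / l0 e) * l0 f" for f
  have l: "l \<in> ?D" "supp l \<subseteq> insert e B" "l e = 1"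
    using lin_subspaceD(2)[OF lin_subspace_dependencies l0(1), of "1 / l0 e"] l0(2) \<open>l0 e \<noteq> 0\<close>
    by (auto simp: l_def[abs_def] supp_def)
  have "positive (sign_vector l)"
    using circ fundamental_circuit_of_dependency(2)[OF E B eB l(1,2)] l(3)
    by (simp add: positive_circuits_at_def)
  then have nonneg: "0 \<le> l f" for f
    unfolding positive_def sign_vector_def
    by (metis insertE linorder_not_less one_neq_neg_one order.asym singletonD zero_neq_neg_one)
  have "(\<Sum>f\<in>B. l f * v f i) = - v e i" if "i < d" for i
  proof -
    have "(\<Sum>f\<in>insert e B. l f * v f i) = 0"
      using dependencies_iff_supported[OF E _ l(2)] l(1) B(1) e that by auto
    then show ?thesis using finB eB l(3) by (simp add: add_eq_0_iff)
  qed
  then show ?cone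
    using B card eB nonneg by blast
next
  let ?D = "dependencies E d v"
  assume ?cone
  then obtain x where B: "B \<subseteq> E" "lin_indep d v B" and card: "card B = d" and eB: "e \<in> E - B"
    and x: "\<forall>f\<in>B. 0 \<le> x f" "\<forall>i<d. (\<Sum>f\<in>B. x f * v f i) = - v e i"
    using e by blast
  have finB: "finite B" using B(1) E finite_subset by blast
  have "is_basis E (sign_circuits ?D) B"
    unfolding is_basis_def indep_set_iff_lin_indep[OF E]
  proof (intro conjI allI impI)
    fix I assume I: "(I \<subseteq> E \<and> lin_indep d v I) \<and> B \<subseteq> I"
    then have "finite I" using E finite_subset by blast
    with I show "I = B"
      using lin_indep_card_le[of I d v] card card_seteq[of I B] by auto
  qed (use B in auto)
  moreover
  define l where "l f = (if f = e then 1 else if f \<in> B then x f else 0)" for f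
  have sub: "supp l \<subseteq> insert e B" by (auto simp: supp_def l_def)
  have "(\<Sum>f\<in>insert e B. l f * v f i) = 0" if "i < d" for i
  proof -
    have "(\<Sum>f\<in>B. l f * v f i) = (\<Sum>f\<in>B. x f * v f i)"
      using eB by (intro sum.cong) (auto simp: l_def)
    then show ?thesis using x(2) that finB eB by (simp add: l_def)
  qed
  then have lD: "l \<in> ?D"
    using dependencies_iff_supported[OF E _ sub] B(1) e by auto
  have "l e > 0" by (simp add: l_def)
  note fc = fundamental_circuit_of_dependency[OF E B eB lD sub this]
  have "positive (sign_vector l)" "sign_vector l e = 1"
    using x(1) by (auto simp: positive_def sign_vector_def l_def)
  ultimately show ?emb
    unfolding embracing_def positive_circuits_at_def fc(2) using eB fc(1) by simp
qed

lemma om_rank_dependencies: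
  assumes E: "finite E" and full: "S \<subseteq> E" "lin_indep d v S" "card S = d"
  shows "om_rank E (sign_circuits (dependencies E d v)) = d"
  unfolding om_rank_def
proof (rule Max_eqI)
  let ?I = "{I. indep_set E (sign_circuits (dependencies E d v)) I}"
  have "?I \<subseteq> Pow E" by (auto simp: indep_set_def)
  then show "finite (card ` ?I)" using E by (meson finite_Pow_iff finite_imageI finite_subset)
  show "y \<le> d" if "y \<in> card ` ?I" for y
    using that lin_indep_card_le[OF finite_subset[OF _ E]]
    by (auto simp: indep_set_iff_lin_indep[OF E])
  show "d \<in> card ` ?I"
    using full by (auto simp: indep_set_iff_lin_indep[OF E])
qed

section \<open>Bases whose cone contains a target, and exchanges between them\<close>

definition cone_basis ::
    "nat \<Rightarrow> nat \<Rightarrow> (nat \<Rightarrow> nat \<Rightarrow> real) \<Rightarrow> (nat \<Rightarrow> real) \<Rightarrow> nat set \<Rightarrow> bool" where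
  "cone_basis n d v p A \<longleftrightarrow> A \<subseteq> {..<n} \<and> card A = d \<and> lin_indep d v A \<and>
     (\<exists>x. (\<forall>f\<in>A. 0 \<le> x f) \<and> (\<forall>i<d. (\<Sum>f\<in>A. x f * v f i) = p i))"

definition exchange :: "'a set \<Rightarrow> 'a set \<Rightarrow> bool" where
  "exchange A A' \<longleftrightarrow> card ((A - A') \<union> (A' - A)) = 2"

text \<open>
  The distance bound is encoded by a potential \<open>\<phi>\<close> that an exchange raises by at most one and that
  is larger at \<open>T\<close> than at \<open>S\<close> by at least \<open>k\<close>. Potentials on two configurations can simply be added, so
  the interleaving of exchanges in a direct sum needs no analysis.
\<close>

definition far_cone_bases :: "nat \<Rightarrow> nat \<Rightarrow> bool" where
  "far_cone_bases d k \<longleftrightarrow>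
     (\<exists>n v p S T. \<exists>\<phi> :: nat set \<Rightarrow> nat. cone_basis n d v p S \<and> cone_basis n d v p T \<and>
        \<phi> S + k \<le> \<phi> T \<and>
        (\<forall>A A'. cone_basis n d v p A \<and> cone_basis n d v p A' \<and> exchange A A' \<longrightarrow>
           \<phi> A' \<le> \<phi> A + 1))"

lemma exchange_iff_card_Diff:
  assumes fin: "finite A" "finite A'" and card: "card A = card A'"
  shows "exchange A A' \<longleftrightarrow> card (A - A') = 1"
proof -
  have "card A = card (A \<inter> A') + card (A - A')" "card A' = card (A \<inter> A') + card (A' - A)"
    using fin by (simp_all add: card_Diff_subset_Int Int_commute card_mono)
  then have eq: "card (A' - A) = card (A - A')" using card by simp
  have "card ((A - A') \<union> (A' - A)) = card (A - A') + card (A' - A)"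
    using fin by (intro card_Un_disjoint) auto
  then show "exchange A A' \<longleftrightarrow> card (A - A') = 1" using eq unfolding exchange_def by arith
qed

lemma same_card_Diff_empty:
  assumes "finite A" "finite A'" "card A = card A'" "card (A - A') = 0"
  shows "A = A'"
  using assms by (metis card_0_eq card_subset_eq finite_Diff Diff_eq_empty_iff)

section \<open>Direct sums\<close>

definition upper_part :: "nat \<Rightarrow> nat set \<Rightarrow> nat set" where
  "upper_part n A = {t. n + t \<in> A}"

text \<open>
  The direct sum places the second family after the first \<open>n\<close> indices and uses the coordinates from
  \<open>d\<close> on for it.
\<close>

definition block_sum :: "nat \<Rightarrow> nat \<Rightarrow> (nat \<Rightarrow> nat \<Rightarrow> real) \<Rightarrow> (nat \<Rightarrow> nat \<Rightarrow> real)
    \<Rightarrow> nat \<Rightarrow> nat \<Rightarrow> real" where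
  "block_sum n d v w f i =
     (if f < n then if i < d then v f i else 0 else if i < d then 0 else w (f - n) (i - d))"

lemma split_at:
  fixes A :: "nat set"
  shows "A = (A \<inter> {..<n}) \<union> (+) n ` upper_part n A"
    and "(A \<inter> {..<n}) \<inter> (+) n ` upper_part n A = {}"
proof -
  have "x \<in> (+) n ` upper_part n A" if "x \<in> A" "\<not> x < n" for x
    using that by (intro image_eqI[of _ _ "x - n"]) (auto simp: upper_part_def)
  then show "A = (A \<inter> {..<n}) \<union> (+) n ` upper_part n A"
    by (auto simp: upper_part_def)
qed auto

lemma finite_upper_part: "finite A \<Longrightarrow> finite (upper_part n A)"
  unfolding upper_part_def by (rule finite_subset[of _ "(\<lambda>x. x - n) ` A"]) force+

lemma card_split_at:
  assumes "finite A"
  shows "card A = card (A \<inter> {..<n}) + card (upper_part n A)"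
proof -
  have "card A = card (A \<inter> {..<n}) + card ((+) n ` upper_part n A)"
    using card_Un_disjoint[OF _ _ split_at(2)[of A n]] assms finite_upper_part[of A n]
      split_at(1)[of A n] by simp
  then show ?thesis by (simp add: card_image)
qed

lemma sum_block_sum:
  assumes "finite A"
  shows "i < d \<Longrightarrow> (\<Sum>f\<in>A. l f * block_sum n d v w f i) = (\<Sum>f\<in>A \<inter> {..<n}. l f * v f i)"
    and "(\<Sum>f\<in>A. l f * block_sum n d v w f (d + j)) = (\<Sum>t\<in>upper_part n A. l (n + t) * w t j)"
proof -
  have split: "(\<Sum>f\<in>A. g f) = (\<Sum>f\<in>A \<inter> {..<n}. g f) + (\<Sum>t\<in>upper_part n A. g (n + t))"
    for g :: "nat \<Rightarrow> real"
  proof -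
    have "(\<Sum>f\<in>A. g f) = (\<Sum>f\<in>A \<inter> {..<n}. g f) + (\<Sum>f\<in>(+) n ` upper_part n A. g f)"
      using sum.union_disjoint[OF _ _ split_at(2)[of A n]] assms finite_upper_part[of A n]
        split_at(1)[of A n] by simp
    then show ?thesis by (simp add: sum.reindex)
  qed
  show "(\<Sum>f\<in>A. l f * block_sum n d v w f i) = (\<Sum>f\<in>A \<inter> {..<n}. l f * v f i)" if "i < d"
    unfolding split[of "\<lambda>f. l f * block_sum n d v w f i"] using that by (simp add: block_sum_def)
  show "(\<Sum>f\<in>A. l f * block_sum n d v w f (d + j)) = (\<Sum>t\<in>upper_part n A. l (n + t) * w t j)"
    unfolding split[of "\<lambda>f. l f * block_sum n d v w f (d + j)"] by (simp add: block_sum_def)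
qed

lemma all_less_add_iff:
  "(\<forall>i<d + d'. P i) \<longleftrightarrow> (\<forall>i<d. P i) \<and> (\<forall>j<d'. P (d + j))" for d d' :: nat
proof
  assume *: "(\<forall>i<d. P i) \<and> (\<forall>j<d'. P (d + j))"
  show "\<forall>i<d + d'. P i"
  proof (intro allI impI)
    fix i assume "i < d + d'"
    then show "P i" using * by (cases "i < d") (auto dest: spec[of _ "i - d"])
  qed
qed auto

lemma sum_block_sum_eq_iff:
  assumes "finite A"
  shows "(\<forall>i<d + d'. (\<Sum>f\<in>A. l f * block_sum n d v w f i) = (if i < d then p i else q (i - d))) \<longleftrightarrow>
    (\<forall>i<d. (\<Sum>f\<in>A \<inter> {..<n}. l f * v f i) = p i) \<and>
    (\<forall>j<d'. (\<Sum>t\<in>upper_part n A. l (n + t) * w t j) = q j)"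
  unfolding all_less_add_iff using sum_block_sum[OF assms] by simp

definition glue :: "nat \<Rightarrow> (nat \<Rightarrow> real) \<Rightarrow> (nat \<Rightarrow> real) \<Rightarrow> nat \<Rightarrow> real" where
  "glue n x y f = (if f < n then x f else y (f - n))"

lemma sum_glue:
  "(\<Sum>f\<in>A \<inter> {..<n}. glue n x y f * v f i) = (\<Sum>f\<in>A \<inter> {..<n}. x f * v f i)"
  "glue n x y (n + t) = y t"
  by (auto simp: glue_def intro!: sum.cong)

lemma lin_indep_block_sum_iff:
  assumes A: "finite A"
  shows "lin_indep (d + d') (block_sum n d v w) A \<longleftrightarrow>
    lin_indep d v (A \<inter> {..<n}) \<and> lin_indep d' w (upper_part n A)"
proof
  have eq: "(\<forall>i<d + d'. (\<Sum>f\<in>A. l f * block_sum n d v w f i) = 0) \<longleftrightarrow>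
      (\<forall>i<d. (\<Sum>f\<in>A \<inter> {..<n}. l f * v f i) = 0) \<and>
      (\<forall>j<d'. (\<Sum>t\<in>upper_part n A. l (n + t) * w t j) = 0)" for l
    using sum_block_sum_eq_iff[OF A, of d d' l n v w "\<lambda>_. 0" "\<lambda>_. 0"] by simp
  {
    assume ind: "lin_indep (d + d') (block_sum n d v w) A"
    have zero: "\<forall>f\<in>A. glue n x y f = 0"
      if "\<forall>i<d. (\<Sum>f\<in>A \<inter> {..<n}. x f * v f i) = 0"
        "\<forall>j<d'. (\<Sum>t\<in>upper_part n A. y t * w t j) = 0" for x y
    proof -
      have "\<forall>i<d + d'. (\<Sum>f\<in>A. glue n x y f * block_sum n d v w f i) = 0"
        unfolding eq sum_glue using that by blast
      then show ?thesis using ind unfolding lin_indep_def by blast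
    qed
    have "lin_indep d v (A \<inter> {..<n})"
      unfolding lin_indep_def
    proof (intro allI impI ballI)
      fix x f assume "\<forall>i<d. (\<Sum>f\<in>A \<inter> {..<n}. x f * v f i) = 0" and f: "f \<in> A \<inter> {..<n}"
      then have "glue n x (\<lambda>_. 0) f = 0" using zero[of x "\<lambda>_. 0"] by simp
      then show "x f = 0" using f by (simp add: glue_def)
    qed
    moreover have "lin_indep d' w (upper_part n A)"
      unfolding lin_indep_def
    proof (intro allI impI ballI)
      fix y t assume "\<forall>j<d'. (\<Sum>t\<in>upper_part n A. y t * w t j) = 0" and t: "t \<in> upper_part n A"
      then have "glue n (\<lambda>_. 0) y (n + t) = 0"
        using zero[of "\<lambda>_. 0" y] by (simp add: upper_part_def)
      then show "y t = 0" by (simp add: sum_glue)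
    qed
    ultimately show "lin_indep d v (A \<inter> {..<n}) \<and> lin_indep d' w (upper_part n A)" ..
  next
    assume ind: "lin_indep d v (A \<inter> {..<n}) \<and> lin_indep d' w (upper_part n A)"
    show "lin_indep (d + d') (block_sum n d v w) A"
      unfolding lin_indep_def eq
    proof (intro allI impI ballI)
      fix l f
      assume l: "(\<forall>i<d. (\<Sum>f\<in>A \<inter> {..<n}. l f * v f i) = 0) \<and>
        (\<forall>j<d'. (\<Sum>t\<in>upper_part n A. l (n + t) * w t j) = 0)" and f: "f \<in> A"
      have low: "\<forall>f\<in>A \<inter> {..<n}. l f = 0"
        using ind l unfolding lin_indep_def by blast
      have "\<forall>t\<in>upper_part n A. l (n + t) = 0"
        using ind l unfolding lin_indep_def by (elim conjE allE[of _ "\<lambda>t. l (n + t)"]) simp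
      then have "l (n + (f - n)) = 0" if "\<not> f < n"
        using f that by (auto simp: upper_part_def dest: spec[of _ "f - n"])
      then show "l f = 0"
        using low f by (cases "f < n") auto
    qed
  }
qed

text \<open>
  Both parts of an independent set are independent, so they have at most \<open>d\<close> and \<open>d'\<close> elements. If the
  total is \<open>d + d'\<close>, each part is therefore a basis of its own summand.
\<close>

lemma cone_basis_block_sum_iff:
  "cone_basis (n + n') (d + d') (block_sum n d v w) (\<lambda>i. if i < d then p i else q (i - d)) A \<longleftrightarrow>
   cone_basis n d v p (A \<inter> {..<n}) \<and> cone_basis n' d' w q (upper_part n A)"
    (is "?L \<longleftrightarrow> ?R")
proof -
  have sub: "A \<subseteq> {..<n + n'} \<longleftrightarrow> upper_part n A \<subseteq> {..<n'}"
  proof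
    assume "upper_part n A \<subseteq> {..<n'}"
    then have "(A \<inter> {..<n}) \<union> (+) n ` upper_part n A \<subseteq> {..<n + n'}" by auto
    then show "A \<subseteq> {..<n + n'}" using split_at(1)[of A n] by simp
  qed (auto simp: upper_part_def)
  show ?thesis
  proof (cases "A \<subseteq> {..<n + n'}")
    case False
    then show ?thesis unfolding cone_basis_def sub by blast
  next
    case True
    then have A: "finite A" using finite_subset by blast
    let ?A = "A \<inter> {..<n}" and ?B = "upper_part n A"
    have "card A = d + d' \<longleftrightarrow> card ?A = d \<and> card ?B = d'"
      if "lin_indep d v ?A" "lin_indep d' w ?B"
      using lin_indep_card_le[OF _ that(1)] lin_indep_card_le[OF _ that(2)]
        card_split_at[OF A, of n] A finite_upper_part[OF A, of n] by auto
    moreover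
    have "(\<exists>x. (\<forall>f\<in>A. 0 \<le> x f) \<and> (\<forall>i<d + d'. (\<Sum>f\<in>A. x f * block_sum n d v w f i)
            = (if i < d then p i else q (i - d)))) \<longleftrightarrow>
        (\<exists>x. (\<forall>f\<in>?A. 0 \<le> x f) \<and> (\<forall>i<d. (\<Sum>f\<in>?A. x f * v f i) = p i)) \<and>
        (\<exists>y. (\<forall>t\<in>?B. 0 \<le> y t) \<and> (\<forall>j<d'. (\<Sum>t\<in>?B. y t * w t j) = q j))"
      (is "?l \<longleftrightarrow> ?r")
    proof
      assume ?l
      then obtain x where x: "\<forall>f\<in>A. 0 \<le> x f"
          "\<forall>i<d. (\<Sum>f\<in>?A. x f * v f i) = p i" "\<forall>j<d'. (\<Sum>t\<in>?B. x (n + t) * w t j) = q j"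
        unfolding sum_block_sum_eq_iff[OF A] by blast
      have "\<forall>t\<in>?B. 0 \<le> x (n + t)" using x(1) by (simp add: upper_part_def)
      then show ?r
        using x by (intro conjI exI[of _ x] exI[of _ "\<lambda>t. x (n + t)"]) auto
    next
      assume ?r
      then obtain x y where x: "\<forall>f\<in>?A. 0 \<le> x f" "\<forall>i<d. (\<Sum>f\<in>?A. x f * v f i) = p i"
          and y: "\<forall>t\<in>?B. 0 \<le> y t" "\<forall>j<d'. (\<Sum>t\<in>?B. y t * w t j) = q j"
        by blast
      have "\<forall>f\<in>A. 0 \<le> glue n x y f"
      proof
        fix f assume f: "f \<in> A"
        show "0 \<le> glue n x y f"
        proof (cases "f < n")
          case False
          then have "f - n \<in> ?B" using f by (simp add: upper_part_def)
          then show ?thesis using False y(1) by (simp add: glue_def)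
        qed (use f x(1) in \<open>simp add: glue_def\<close>)
      qed
      then show ?l
        unfolding sum_block_sum_eq_iff[OF A] using x(2) y(2)
        by (intro exI[of _ "glue n x y"]) (simp add: sum_glue)
    qed
    ultimately show ?thesis
      unfolding cone_basis_def lin_indep_block_sum_iff[OF A] sub by blast
  qed
qed

text \<open>
  An exchange in a direct sum happens inside one summand, because each part keeps its
  cardinality: removing an element from one part and adding one to the other would leave bases of the
  wrong size. Hence the sum of the two potentials is again raised by at most one.
\<close>

lemma far_cone_bases_add:
  assumes "far_cone_bases d k" "far_cone_bases d' k'"
  shows "far_cone_bases (d + d') (k + k')"
proof -
  obtain n v p S T and \<phi> :: "nat set \<Rightarrow> nat" where
    ST: "cone_basis n d v p S" "cone_basis n d v p T" "\<phi> S + k \<le> \<phi> T" and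
    lip: "\<And>A A'. cone_basis n d v p A \<Longrightarrow> cone_basis n d v p A' \<Longrightarrow> exchange A A' \<Longrightarrow> \<phi> A' \<le> \<phi> A + 1"
    using assms(1) unfolding far_cone_bases_def by blast
  obtain n' w q S' T' and \<psi> :: "nat set \<Rightarrow> nat" where
    ST': "cone_basis n' d' w q S'" "cone_basis n' d' w q T'" "\<psi> S' + k' \<le> \<psi> T'" and
    lip': "\<And>A A'. cone_basis n' d' w q A \<Longrightarrow> cone_basis n' d' w q A' \<Longrightarrow> exchange A A' \<Longrightarrow> \<psi> A' \<le> \<psi> A + 1"
    using assms(2) unfolding far_cone_bases_def by blast
  let ?v = "block_sum n d v w" and ?p = "\<lambda>i. if i < d then p i else q (i - d)"
  let ?cb = "cone_basis (n + n') (d + d') ?v ?p"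
  define \<chi> where "\<chi> A = \<phi> (A \<inter> {..<n}) + \<psi> (upper_part n A)" for A
  have parts: "(X \<union> (+) n ` Y) \<inter> {..<n} = X" "upper_part n (X \<union> (+) n ` Y) = Y"
    if "X \<subseteq> {..<n}" for X Y
    using that by (auto simp: upper_part_def)
  have sub: "S \<subseteq> {..<n}" "T \<subseteq> {..<n}"
    using ST by (auto simp: cone_basis_def)
  have "?cb (S \<union> (+) n ` S')" "?cb (T \<union> (+) n ` T')"
    unfolding cone_basis_block_sum_iff using ST ST' sub by (simp_all add: parts)
  moreover have "\<chi> (S \<union> (+) n ` S') + (k + k') \<le> \<chi> (T \<union> (+) n ` T')"
    using ST(3) ST'(3) sub by (simp add: \<chi>_def parts)
  moreover have "\<chi> A' \<le> \<chi> A + 1" if cb: "?cb A" "?cb A'" and ex: "exchange A A'" for A A'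
  proof -
    let ?A = "A \<inter> {..<n}" and ?A' = "A' \<inter> {..<n}"
    let ?B = "upper_part n A" and ?B' = "upper_part n A'"
    have fin: "finite A" "finite A'"
      using cb finite_subset unfolding cone_basis_def by blast+
    have cbA: "cone_basis n d v p ?A" "cone_basis n d v p ?A'"
      and cbB: "cone_basis n' d' w q ?B" "cone_basis n' d' w q ?B'"
      using cb unfolding cone_basis_block_sum_iff by auto
    have card: "card ?A = card ?A'" "card ?B = card ?B'" "card A = card A'"
      using cbA cbB cb by (simp_all add: cone_basis_def)
    have finB: "finite ?B" "finite ?B'" using fin by (simp_all add: finite_upper_part)
    have "(A - A') \<inter> {..<n} = ?A - ?A'" "upper_part n (A - A') = ?B - ?B'"
      by (auto simp: upper_part_def)
    then have "card (A - A') = card (?A - ?A') + card (?B - ?B')"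
      using card_split_at[of "A - A'" n] fin by simp
    moreover have "card (A - A') = 1"
      using exchange_iff_card_Diff[OF fin card(3)] ex by simp
    ultimately consider "card (?A - ?A') = 1" "card (?B - ?B') = 0"
      | "card (?A - ?A') = 0" "card (?B - ?B') = 1" by linarith
    then show ?thesis
    proof cases
      case 1
      then have "?B = ?B'" "exchange ?A ?A'"
        using same_card_Diff_empty[OF finB card(2)] exchange_iff_card_Diff[OF _ _ card(1)] fin by auto
      then show ?thesis using lip[OF cbA] by (simp add: \<chi>_def)
    next
      case 2
      then have "?A = ?A'" "exchange ?B ?B'"
        using same_card_Diff_empty[OF _ _ card(1)] exchange_iff_card_Diff[OF finB card(2)] fin by auto
      then show ?thesis using lip'[OF cbB] by (simp add: \<chi>_def)
    qed
  qed
  ultimately show ?thesis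
    unfolding far_cone_bases_def by blast
qed

section \<open>A configuration of rank four with cone bases at distance five\<close>

lemma far_cone_bases_0: "far_cone_bases 0 0"
  unfolding far_cone_bases_def
  by (intro exI[of _ 0] exI[of _ "\<lambda>_ _. 0"] exI[of _ "\<lambda>_. 0"] exI[of _ "{}"])
    (auto simp: cone_basis_def lin_indep_def)

text \<open>
  Two parallel vectors, each of which spans the ray through the target.
\<close>

lemma far_cone_bases_1: "far_cone_bases 1 1"
proof -
  have "cone_basis 2 1 (\<lambda>_ _. 1) (\<lambda>_. 1) {f}" if "f < 2" for f :: nat
    using that by (auto simp: cone_basis_def lin_indep_def intro: exI[of _ "\<lambda>_. 1"])
  from this[of 0] this[of 1] show ?thesis
    unfolding far_cone_bases_def
    by (intro exI[of _ 2] exI[of _ "\<lambda>_ _. 1"] exI[of _ "\<lambda>_. 1"] exI[of _ "{0}"] exI[of _ "{1}"]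
        exI[of _ "\<lambda>A. if A = {1} then 1 else 0"]) auto
qed

text \<open>
  The nonnegative solutions \<open>x\<close> of \<open>(\<Sum>f<8. x f * kw_vector f i) = kw_target i\<close> form a simple
  four-dimensional polyhedron with at most eight facets \<open>x f = 0\<close>. Its vertices are the solutions supported
  on the cone bases, and its bounded edges are the exchanges. Klee and Walkup found an unbounded polyhedron of
  this size with two vertices at distance five, and these vectors realize such a polyhedron.
  
  The linear map \<open>(a, b, c, d) \<mapsto> (- a, - c, b, d)\<close> fixes the target and permutes the vectors
  cyclically as \<open>0 \<mapsto> 1 \<mapsto> 2 \<mapsto> 3 \<mapsto> 0\<close> and \<open>4 \<mapsto> 5 \<mapsto> 6 \<mapsto> 7 \<mapsto> 4\<close>. It interchanges the two extreme
  bases \<open>{1, 3, 5, 7}\<close> and \<open>{0, 2, 4, 6}\<close>.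
\<close>

definition kw_vector :: "nat \<Rightarrow> nat \<Rightarrow> real" where
  "kw_vector f i =
     [[3, 2, 1, 4], [-3, -1, 2, 4], [3, -2, -1, 4], [-3, 1, -2, 4],
      [-1, 2, 0, -1], [1, 0, 2, -1], [-1, -2, 0, -1], [1, 0, -2, -1]] ! f ! i"

definition kw_target :: "nat \<Rightarrow> real" where
  "kw_target i = (if i = 3 then 1 else 0)"

text \<open>
  For each triple a hyperplane separates the target from the cone of the five other vectors, so a
  set whose cone contains the target meets every triple. Each row is an orbit of the cyclic symmetry.
\<close>

definition kw_triples :: "nat list list" where
  "kw_triples =
     [[0, 1, 2], [1, 2, 3], [0, 2, 3], [0, 1, 3],
      [0, 2, 5], [1, 3, 6], [0, 2, 7], [1, 3, 4],
      [0, 3, 4], [0, 1, 5], [1, 2, 6], [2, 3, 7],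
      [0, 4, 7], [1, 4, 5], [2, 5, 6], [3, 6, 7],
      [0, 4, 5], [1, 5, 6], [2, 6, 7], [3, 4, 7]]"

text \<open>
  The cone bases, arranged by their distance from \<open>{1, 3, 5, 7}\<close>.
\<close>

definition kw_layers :: "nat list list list" where
  "kw_layers =
     [[[1, 3, 5, 7]],
      [[0, 1, 5, 7], [2, 3, 5, 7]],
      [[0, 1, 2, 7], [0, 1, 6, 7], [0, 2, 3, 5], [2, 3, 4, 5]],
      [[0, 1, 2, 3], [1, 2, 4, 7], [0, 1, 3, 6], [0, 3, 5, 6], [1, 2, 3, 4]],
      [[1, 2, 4, 6], [0, 3, 4, 6]],
      [[0, 2, 4, 6]]]"

text \<open>
  The index of the layer of \<open>A\<close>, and \<open>6\<close> for sets outside all layers. Going through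
  \<open>sorted_list_of_set\<close> lets the layers be computed with as plain lists.
\<close>

definition kw_level :: "nat set \<Rightarrow> nat" where
  "kw_level A = length (takeWhile (\<lambda>L. sorted_list_of_set A \<notin> set L) kw_layers)"

lemma kw_equations_iff:
  "(\<forall>i<4. (\<Sum>f<8. x f * kw_vector f i) = kw_target i) \<longleftrightarrow>
     3 * x 0 - 3 * x 1 + 3 * x 2 - 3 * x 3 - x 4 + x 5 - x 6 + x 7 = 0 \<and>
     2 * x 0 - x 1 - 2 * x 2 + x 3 + 2 * x 4 - 2 * x 6 = 0 \<and>
     x 0 + 2 * x 1 - x 2 - 2 * x 3 + 2 * x 5 - 2 * x 7 = 0 \<and>
     4 * x 0 + 4 * x 1 + 4 * x 2 + 4 * x 3 - x 4 - x 5 - x 6 - x 7 = 1"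
  by (simp add: kw_vector_def kw_target_def eval_nat_numeral All_less_Suc algebra_simps conj_ac)

text \<open>
  If \<open>x\<close> vanished on the triple, the separating hyperplane would give a linear combination of the four
  equations with nonnegative left-hand side and negative right-hand side. Linear arithmetic finds it.
\<close>

lemma kw_triple_hit:
  fixes x :: "nat \<Rightarrow> real"
  assumes eqs: "\<forall>i<4. (\<Sum>f<8. x f * kw_vector f i) = kw_target i"
    and nonneg: "\<And>f. 0 \<le> x f" and t: "t \<in> set kw_triples"
  shows "\<exists>f\<in>set t. x f \<noteq> 0"
proof (rule ccontr)
  assume "\<not> ?thesis"
  then have z: "\<forall>f\<in>set t. x f = 0" by blast
  have n: "0 \<le> x 0" "0 \<le> x 1" "0 \<le> x 2" "0 \<le> x 3" "0 \<le> x 4" "0 \<le> x 5" "0 \<le> x 6" "0 \<le> x 7"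
    using nonneg by auto
  show False
    using t z eqs[unfolded kw_equations_iff] n unfolding kw_triples_def
    by (simp only: list.set insert_iff empty_iff) (elim disjE; clarsimp; linarith)
qed

text \<open>
  This reduces the geometry to finite combinatorics: the triples are numerous enough to exclude every
  set of four indices that is not a cone basis.
\<close>

lemma kw_transversals:
  "\<forall>xs\<in>set (subseqs [0..<8]). length xs = 4 \<and> (\<forall>t\<in>set kw_triples. \<exists>f\<in>set t. f \<in> set xs) \<longrightarrow>
     xs \<in> set (concat kw_layers)"
  by code_simp


lemma kw_layers_sorted_distinct:
  "\<forall>xs\<in>set (concat kw_layers). sorted xs \<and> distinct xs \<and> length xs = 4"
  by code_simp

text \<open>
  The finite heart of the bound: no exchange skips a layer. The two lists have the same length, so a
  single element of \<open>xs\<close> outside \<open>ys\<close> characterizes an exchange.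
\<close>

lemma kw_layers_exchange:
  "\<forall>xs\<in>set (concat kw_layers). \<forall>ys\<in>set (concat kw_layers).
     length (filter (\<lambda>f. f \<notin> set ys) xs) = 1 \<longrightarrow>
     length (takeWhile (\<lambda>L. ys \<notin> set L) kw_layers)
       \<le> length (takeWhile (\<lambda>L. xs \<notin> set L) kw_layers) + 1"
  by code_simp

lemma kw_cone_basis_in_layers:
  assumes "cone_basis 8 4 kw_vector kw_target A"
  shows "\<exists>xs\<in>set (concat kw_layers). A = set xs"
proof -
  obtain x where sub: "A \<subseteq> {..<8}" and card: "card A = 4" and x: "\<forall>f\<in>A. 0 \<le> x f"
    and eqs: "\<forall>i<4. (\<Sum>f\<in>A. x f * kw_vector f i) = kw_target i"
    using assms unfolding cone_basis_def by blast
  \<comment> \<open>Extending the coefficients by zero turns them into a solution of the system in all eight unknowns.\<close>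
  define y where "y f = (if f \<in> A then x f else 0)" for f
  have "(\<Sum>f<8. y f * kw_vector f i) = (\<Sum>f\<in>A. x f * kw_vector f i)" for i
    using sub by (intro sum.mono_neutral_cong_right) (auto simp: y_def)
  then have "\<exists>f\<in>set t. y f \<noteq> 0" if "t \<in> set kw_triples" for t
    using kw_triple_hit[of y t] eqs x that by (simp add: y_def)
  then have hit: "\<exists>f\<in>set t. f \<in> A" if "t \<in> set kw_triples" for t
    using that unfolding y_def by metis
  have "A \<in> set ` set (subseqs [0..<8])"
    unfolding subseqs_powset using sub by auto
  then obtain xs where xs: "xs \<in> set (subseqs [0..<8])" "A = set xs" by blast
  moreover have "length xs = 4"
    using card xs subseqs_distinctD[OF xs(1)] by (simp add: distinct_card)
  ultimately show ?thesis
    using kw_transversals hit by blast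
qed

lemma kw_level_set:
  assumes "xs \<in> set (concat kw_layers)"
  shows "kw_level (set xs) = length (takeWhile (\<lambda>L. xs \<notin> set L) kw_layers)"
  using kw_layers_sorted_distinct assms
  by (simp add: kw_level_def sorted_list_of_set.idem_if_sorted_distinct del: set_concat)

lemma kw_level_exchange:
  assumes "cone_basis 8 4 kw_vector kw_target A" "cone_basis 8 4 kw_vector kw_target A'"
    and ex: "exchange A A'"
  shows "kw_level A' \<le> kw_level A + 1"
proof -
  obtain xs ys where xs: "xs \<in> set (concat kw_layers)" "A = set xs"
      and ys: "ys \<in> set (concat kw_layers)" "A' = set ys"
    using assms(1,2) kw_cone_basis_in_layers by meson
  have d: "distinct xs" "distinct ys" "length xs = 4" "length ys = 4"
    using kw_layers_sorted_distinct xs(1) ys(1) by blast+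
  have "card (A - A') = 1"
    using exchange_iff_card_Diff[of A A'] ex d xs ys by (simp add: distinct_card)
  moreover have "A - A' = set (filter (\<lambda>f. f \<notin> set ys) xs)"
    using xs ys by auto
  ultimately have "length (filter (\<lambda>f. f \<notin> set ys) xs) = 1"
    using d(1) distinct_card[of "filter (\<lambda>f. f \<notin> set ys) xs"] by simp
  then show ?thesis
    using kw_layers_exchange xs ys kw_level_set by metis
qed

lemma far_cone_bases_4: "far_cone_bases 4 5"
proof -
  have "cone_basis 8 4 kw_vector kw_target {1, 3, 5, 7}"
    unfolding cone_basis_def
  proof (intro conjI exI[of _ "\<lambda>f. if f < 4 then 1 / 2 else 3 / 2"])
    show "lin_indep 4 kw_vector {1, 3, 5, 7}"
      unfolding lin_indep_def
      by (simp add: kw_vector_def eval_nat_numeral All_less_Suc)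
  qed (auto simp: kw_vector_def kw_target_def eval_nat_numeral All_less_Suc)
  moreover have "cone_basis 8 4 kw_vector kw_target {0, 2, 4, 6}"
    unfolding cone_basis_def
  proof (intro conjI exI[of _ "\<lambda>f. if f < 4 then 1 / 2 else 3 / 2"])
    show "lin_indep 4 kw_vector {0, 2, 4, 6}"
      unfolding lin_indep_def
      by (simp add: kw_vector_def eval_nat_numeral All_less_Suc)
  qed (auto simp: kw_vector_def kw_target_def eval_nat_numeral All_less_Suc)
  moreover have "kw_level {1, 3, 5, 7} = 0" "kw_level {0, 2, 4, 6} = 5"
    using kw_level_set[of "[1, 3, 5, 7]"] kw_level_set[of "[0, 2, 4, 6]"]
    by (simp_all add: kw_layers_def)
  ultimately show ?thesis
    unfolding far_cone_bases_def using kw_level_exchange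
    by (intro exI[of _ 8] exI[of _ kw_vector] exI[of _ kw_target] exI[of _ "{1, 3, 5, 7}"]
        exI[of _ "{0, 2, 4, 6}"] exI[of _ kw_level]) auto
qed

section \<open>Many copies of the configuration\<close>

lemma far_cone_bases_mult:
  assumes "far_cone_bases d k"
  shows "far_cone_bases (m * d) (m * k)"
proof (induction m)
  case 0
  show ?case using far_cone_bases_0 by simp
next
  case (Suc m)
  then show ?case using far_cone_bases_add[OF assms] by simp
qed

text \<open>
  With \<open>r = 4 * q + s\<close> and \<open>s < 4\<close>, the bound is \<open>5 * q + s\<close> since \<open>s / 4 < 1\<close>. So \<open>q\<close> summands of rank four
  contribute five each, and every remaining rank contributes one.
\<close>

lemma far_cone_bases_five_quarters: "far_cone_bases r (nat \<lfloor>5 / 4 * real r\<rfloor>)"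
proof -
  define q s where "q = r div 4" and "s = r mod 4"
  have r: "r = q * 4 + s * 1" and s: "s < 4"
    by (simp_all add: q_def s_def)
  have "\<lfloor>5 / 4 * real r\<rfloor> = int (q * 5 + s * 1)"
    using s unfolding r floor_eq_iff by (simp add: field_simps)
  then have "nat \<lfloor>5 / 4 * real r\<rfloor> = q * 5 + s * 1" by simp
  then show ?thesis
    using far_cone_bases_add[OF far_cone_bases_mult[OF far_cone_bases_4, of q]
        far_cone_bases_mult[OF far_cone_bases_1, of s]] r by simp
qed

lemma embracing_path_potential_le:
  assumes path: "embracing_path E C e B B' k"
    and lip: "\<And>A A'. embracing E C e A \<Longrightarrow> embracing E C e A' \<Longrightarrow> exchange A A' \<Longrightarrow>
      \<phi> A' \<le> \<phi> A + 1"
  shows "\<phi> B' \<le> \<phi> B + (k :: nat)"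
proof -
  obtain Bs where Bs: "Bs 0 = B" "Bs k = B'" "\<And>i. i \<le> k \<Longrightarrow> embracing E C e (Bs i)"
    and ex: "\<And>i. i \<in> {1..k} \<Longrightarrow> exchange (Bs (i - 1)) (Bs i)"
    using path unfolding embracing_path_def exchange_def by blast
  have "i \<le> k \<Longrightarrow> \<phi> (Bs i) \<le> \<phi> B + i" for i
  proof (induction i)
    case 0
    then show ?case using Bs(1) by simp
  next
    case (Suc i)
    then show ?case
      using lip[OF Bs(3)[of i] Bs(3)[of "Suc i"]] ex[of "Suc i"] by fastforce
  qed
  from this[of k] show ?thesis using Bs(2) by simp
qed

text \<open>
  The vectors of the configuration together with the negative of the target, which takes the role of
  \<open>e\<close>, form the oriented matroid. The distance bound is then the potential bound along a path.
\<close>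

theorem corollary1p4:
  fixes r :: nat
  assumes "r \<ge> 1"
  shows "\<exists>(E :: nat set) (C :: (nat \<Rightarrow> int) set) (e :: nat) (B :: nat set) (B' :: nat set).
           oriented_matroid E C \<and> realizable E C \<and> om_rank E C = r \<and> e \<in> E \<and>
           embracing E C e B \<and> embracing E C e B' \<and>
           embracing_dist E C e B B' \<ge> enat (nat \<lfloor>5 / 4 * real r\<rfloor>)"
proof -
  define k where "k = nat \<lfloor>5 / 4 * real r\<rfloor>"
  obtain n v p S T and \<phi> :: "nat set \<Rightarrow> nat" where
    ST: "cone_basis n r v p S" "cone_basis n r v p T" "\<phi> S + k \<le> \<phi> T" and
    lip: "\<And>A A'. cone_basis n r v p A \<Longrightarrow> cone_basis n r v p A' \<Longrightarrow> exchange A A' \<Longrightarrow> \<phi> A' \<le> \<phi> A + 1"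
    using far_cone_bases_five_quarters[of r] unfolding far_cone_bases_def k_def by blast
  define E where "E = {..n}"
  define w where "w = v(n := \<lambda>i. - p i)"
  define C where "C = sign_circuits (dependencies E r w)"
  have fin: "finite E" and nE: "n \<in> E" by (simp_all add: E_def)
  have sum_w: "(\<Sum>f\<in>A. l f * w f i) = (\<Sum>f\<in>A. l f * v f i)" if "A \<subseteq> {..<n}" for A l i
    using that by (intro sum.cong) (auto simp: w_def)
  have ind_w: "lin_indep r w A \<longleftrightarrow> lin_indep r v A" if "A \<subseteq> {..<n}" for A
    unfolding lin_indep_def sum_w[OF that] ..
  have S: "S \<subseteq> E" "lin_indep r w S" "card S = r"
    using ST(1) ind_w[of S] by (auto simp: cone_basis_def E_def)
  have En: "E - {n} = {..<n}" by (auto simp: E_def)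
  have emb: "embracing E C n A \<longleftrightarrow> cone_basis n r v p A" for A
  proof (cases "A \<subseteq> {..<n}")
    case True
    show ?thesis
      unfolding C_def embracing_iff_cone_basis[OF fin nE S] En cone_basis_def ind_w[OF True] sum_w[OF True]
      by (auto simp: w_def)
  next
    case False
    then show ?thesis
      unfolding C_def embracing_iff_cone_basis[OF fin nE S] En cone_basis_def by blast
  qed
  have "enat k \<le> embracing_dist E C n S T"
    unfolding embracing_dist_def
  proof (rule Inf_greatest)
    fix m assume "m \<in> {enat k |k. embracing_path E C n S T k}"
    then obtain j where j: "m = enat j" "embracing_path E C n S T j" by blast
    have "\<phi> T \<le> \<phi> S + j"
      using embracing_path_potential_le[OF j(2), of \<phi>] lip unfolding emb by blast
    then show "enat k \<le> m" using ST(3) j(1) by simp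
  qed
  moreover have "oriented_matroid E C"
    unfolding C_def
    by (rule sign_circuits_oriented_matroid[OF fin lin_subspace_dependencies])
      (simp add: dependencies_def)
  moreover have "realizable E C"
    unfolding realizable_def C_def dependencies_def using fin by blast
  moreover have "om_rank E C = r"
    unfolding C_def by (rule om_rank_dependencies[OF fin S])
  ultimately show ?thesis
    using nE ST(1,2) emb unfolding k_def by blast
qed

end
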